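(* Let $S=S(\mathbf d^m)$ be a numerical semigroup of maximal embedding dimension, minimally generated by $\mathbf d^m=\{d_1,\dots,d_m\}$ with $m=d_1<d_2<\dots<d_m$, $m\ge 2$. Then $S$ is almost symmetric if and only if $$d_j+d_{m-j+1}=m+d_m\qquad\text{for all } 1\le j\le m .$$
   Context: Here $\gcd(d_1,\dots,d_m)=1$, no $d_i$ is a nonnegative integer linear combination of the other $d_j$, and $S=\{\sum_{i=1}^m x_id_i : x_i\in\mathbb Z_{\ge 0}\}$. One always has $d_1\ge m$; $S$ is of maximal embedding dimension (MED) if $d_1=m$. The Frobenius number $F$ is the largest integer not in $S$. Put $S'=\{x\in\mathbb Z : x\notin S,\ x+s\in S \text{ for all } s\in S\setminus\{0\}\}$ and $\Delta_{\mathcal H}=\{h\in\mathbb Z : h\notin S,\ F-h\notin S\}$. $S$ is almost symmetric if $S'\setminus\{F\}=\Delta_{\mathcal H}$. *)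

theory Defs
  imports Main
begin

definition combinations :: "nat set \<Rightarrow> (nat \<Rightarrow> nat) \<Rightarrow> int set" where
  "combinations I d = {\<Sum>i\<in>I. int (x i) * int (d i) | x :: nat \<Rightarrow> nat. True}"

definition semigroup_generated :: "nat \<Rightarrow> (nat \<Rightarrow> nat) \<Rightarrow> int set" where
  "semigroup_generated m d = combinations {1..m} d"

(* The generators are positive: a zero generator would be the trivial
   combination of the others, which the second conjunct excludes. *)
definition minimal_generators :: "nat \<Rightarrow> (nat \<Rightarrow> nat) \<Rightarrow> bool" where
  "minimal_generators m d \<longleftrightarrow>
     Gcd (d ` {1..m}) = 1 \<and>
     (\<forall>i\<in>{1..m}. int (d i) \<notin> combinations ({1..m} - {i}) d)"

(* Only meaningful for generators listed in increasing order, where d 1 is the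
   multiplicity and m the embedding dimension. *)
definition max_embedding_dim :: "nat \<Rightarrow> (nat \<Rightarrow> nat) \<Rightarrow> bool" where
  "max_embedding_dim m d \<longleftrightarrow> d 1 = m"

definition frobenius_number :: "int set \<Rightarrow> int" where
  "frobenius_number S = (GREATEST x. x \<notin> S)"

(* The set written S' in the literature. *)
definition pseudo_frobenius :: "int set \<Rightarrow> int set" where
  "pseudo_frobenius S = {x. x \<notin> S \<and> (\<forall>s\<in>S - {0}. x + s \<in> S)}"

(* The set written Delta_H in the literature. *)
definition symmetric_gaps :: "int set \<Rightarrow> int set" where
  "symmetric_gaps S = {h. h \<notin> S \<and> frobenius_number S - h \<notin> S}"

definition almost_symmetric :: "int set \<Rightarrow> bool" where
  "almost_symmetric S \<longleftrightarrow> pseudo_frobenius S - {frobenius_number S} = symmetric_gaps S"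

end

theory Submission
  imports Defs
begin

text \<open>
  Maximal embedding dimension makes the generators a complete residue system modulo \<open>m\<close>, so
  membership of \<open>d\<^sub>i + k m\<close> in \<open>S\<close> depends only on the sign of \<open>k\<close> (except for \<open>i = 1\<close>). Hence
  \<open>F = d\<^sub>m - m\<close> and \<open>S' = {d\<^sub>i - m | 2 \<le> i \<le> m}\<close>. Since \<open>\<Delta>\<^sub>H\<close> is invariant under \<open>h \<mapsto> F - h\<close>,
  almost symmetry turns \<open>d\<^sub>i \<mapsto> m + d\<^sub>m - d\<^sub>i\<close> into an order-reversing permutation of the generators,
  which can only be \<open>d\<^sub>i \<mapsto> d\<^bsub>m+1-i\<^esub>\<close>.
\<close>

section \<open>Nonnegative integer combinations\<close>

lemma combinations_nonneg: "x \<in> combinations I d \<Longrightarrow> 0 \<le> x"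
  unfolding combinations_def by (auto intro!: sum_nonneg)

lemma combinations_add:
  assumes "x \<in> combinations I d" "y \<in> combinations I d"
  shows "x + y \<in> combinations I d"
proof -
  obtain f g :: "nat \<Rightarrow> nat" where
    "x = (\<Sum>i\<in>I. int (f i) * int (d i))" "y = (\<Sum>i\<in>I. int (g i) * int (d i))"
    using assms unfolding combinations_def by blast
  then have "x + y = (\<Sum>i\<in>I. int (f i + g i) * int (d i))"
    by (simp add: sum.distrib algebra_simps)
  then show ?thesis
    unfolding combinations_def by (intro CollectI exI[of _ "\<lambda>i. f i + g i"]) simp
qed

lemma combinations_mult:
  assumes "finite I" "i \<in> I"
  shows "int k * int (d i) \<in> combinations I d"
proof -
  have "(\<Sum>j\<in>I. int (if j = i then k else 0) * int (d j)) =
        (\<Sum>j\<in>I. if j = i then int k * int (d j) else 0)"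
    by (rule sum.cong) auto
  also have "\<dots> = int k * int (d i)"
    using assms by (simp add: sum.delta)
  finally show ?thesis
    unfolding combinations_def by (intro CollectI exI[of _ "\<lambda>j. if j = i then k else 0"]) simp
qed

lemma combinations_eq_0_or_diff:
  assumes "finite I" "x \<in> combinations I d"
  shows "x = 0 \<or> (\<exists>i\<in>I. x - int (d i) \<in> combinations I d)"
proof -
  obtain f :: "nat \<Rightarrow> nat" where f: "x = (\<Sum>i\<in>I. int (f i) * int (d i))"
    using assms unfolding combinations_def by blast
  show ?thesis
  proof (cases "\<forall>i\<in>I. f i = 0")
    case True
    then show ?thesis using f by simp
  next
    case False
    then obtain i where i: "i \<in> I" "f i \<noteq> 0" by blast
    let ?g = "f(i := f i - 1)"
    have "x = int (f i) * int (d i) + (\<Sum>j\<in>I - {i}. int (f j) * int (d j))"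
      using f assms(1) i(1) by (simp add: sum.remove)
    moreover have "(\<Sum>j\<in>I. int (?g j) * int (d j)) =
        int (f i - 1) * int (d i) + (\<Sum>j\<in>I - {i}. int (f j) * int (d j))"
      using assms(1) i(1) by (simp add: sum.remove)
    ultimately have "x - int (d i) = (\<Sum>j\<in>I. int (?g j) * int (d j))"
      using i(2) by (simp add: of_nat_diff algebra_simps)
    then show ?thesis
      using i(1) unfolding combinations_def by blast
  qed
qed

text \<open>All summands are nonnegative, so a positive coefficient of \<open>d i\<close> would
  already push the sum up to \<open>d i\<close>.\<close>

lemma combinations_remove_greater:
  assumes "finite I" "x \<in> combinations I d" "x < int (d i)"
  shows "x \<in> combinations (I - {i}) d"
proof -
  obtain f :: "nat \<Rightarrow> nat" where f: "x = (\<Sum>j\<in>I. int (f j) * int (d j))"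
    using assms unfolding combinations_def by blast
  have "x = (\<Sum>j\<in>I - {i}. int (f j) * int (d j))"
  proof (cases "i \<in> I")
    case True
    have rest: "0 \<le> (\<Sum>j\<in>I - {i}. int (f j) * int (d j))"
      by (intro sum_nonneg) auto
    have split: "x = int (f i) * int (d i) + (\<Sum>j\<in>I - {i}. int (f j) * int (d j))"
      using f assms(1) True by (simp add: sum.remove)
    have "f i = 0"
    proof (rule ccontr)
      assume "f i \<noteq> 0"
      then have "1 * int (d i) \<le> int (f i) * int (d i)"
        by (intro mult_right_mono) auto
      then show False using split rest assms(3) by linarith
    qed
    then show ?thesis using split by simp
  next
    case False
    then show ?thesis using f by simp
  qed
  then show ?thesis unfolding combinations_def by blast
qed

section \<open>Rigidity of strictly increasing self-maps\<close>

text \<open>Each step gains at least one: counting up from 1 bounds \<open>f\<close> from below,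
  counting down from \<open>m\<close> bounds it from above.\<close>

lemma strict_mono_on_self_map_eq:
  fixes f :: "nat \<Rightarrow> nat"
  assumes mono: "strict_mono_on {1..m} f" and maps: "f ` {1..m} \<subseteq> {1..m}" and i: "i \<in> {1..m}"
  shows "f i = i"
proof -
  have lower: "j \<in> {1..m} \<Longrightarrow> j \<le> f j" for j
  proof (induction j)
    case (Suc j)
    show ?case
    proof (cases "j = 0")
      case True
      then show ?thesis using maps Suc.prems by fastforce
    next
      case False
      then have "j \<in> {1..m}" using Suc.prems by auto
      moreover from this have "f j < f (Suc j)"
        using strict_mono_onD[OF mono] Suc.prems by simp
      ultimately show ?thesis using Suc.IH by simp
    qed
  qed simp
  have upper: "k < m \<Longrightarrow> f (m - k) \<le> m - k" for k
  proof (induction k)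
    case 0
    then have "m \<in> {1..m}" by simp
    then have "f m \<in> {1..m}" using maps by blast
    then show ?case by simp
  next
    case (Suc k)
    then have "f (m - Suc k) < f (m - k)"
      by (intro strict_mono_onD[OF mono]) auto
    then show ?case using Suc by simp
  qed
  show ?thesis using lower[OF i] upper[of "m - i"] i by simp
qed

section \<open>Generators of a semigroup of maximal embedding dimension\<close>

locale med_semigroup =
  fixes m :: nat and d :: "nat \<Rightarrow> nat"
  assumes m_ge_2: "2 \<le> m"
    and minimal: "minimal_generators m d"
    and mono: "strict_mono_on {1..m} d"
    and med: "max_embedding_dim m d"
begin

abbreviation "S \<equiv> semigroup_generated m d"

lemma d_1 [simp]: "d (Suc 0) = m"
  using med by (simp add: max_embedding_dim_def)

lemma d_less_iff: "i \<in> {1..m} \<Longrightarrow> j \<in> {1..m} \<Longrightarrow> d i < d j \<longleftrightarrow> i < j"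
  by (rule strict_mono_on_less[OF mono])

lemma d_le_iff: "i \<in> {1..m} \<Longrightarrow> j \<in> {1..m} \<Longrightarrow> d i \<le> d j \<longleftrightarrow> i \<le> j"
  using d_less_iff[of j i] by auto

lemma d_ge_m: "i \<in> {1..m} \<Longrightarrow> m \<le> d i"
  using d_le_iff[of 1 i] by simp

lemma S_nonneg: "x \<in> S \<Longrightarrow> 0 \<le> x"
  unfolding semigroup_generated_def by (rule combinations_nonneg)

lemma S_add: "x \<in> S \<Longrightarrow> y \<in> S \<Longrightarrow> x + y \<in> S"
  unfolding semigroup_generated_def by (rule combinations_add)

lemma gen_in_S: "i \<in> {1..m} \<Longrightarrow> int (d i) \<in> S"
  unfolding semigroup_generated_def using combinations_mult[of "{1..m}" i 1 d] by simp

lemma mult_m_in_S: "0 \<le> k \<Longrightarrow> k * int m \<in> S"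
  unfolding semigroup_generated_def
  using combinations_mult[of "{1..m}" 1 "nat k" d] m_ge_2 by simp

text \<open>Both summands would be smaller than \<open>d i\<close>, hence combinations of the other
  generators, and so would be their sum, against minimality.\<close>

lemma gen_irreducible:
  assumes "i \<in> {1..m}" "x \<in> S" "x \<noteq> 0" "y \<in> S" "y \<noteq> 0"
  shows "x + y \<noteq> int (d i)"
proof
  assume sum: "x + y = int (d i)"
  then have "x < int (d i)" "y < int (d i)"
    using S_nonneg[OF assms(2)] S_nonneg[OF assms(4)] assms(3,5) by auto
  then have "x + y \<in> combinations ({1..m} - {i}) d"
    using assms(2,4) unfolding semigroup_generated_def
    by (intro combinations_add combinations_remove_greater) auto
  then show False
    using minimal assms(1) sum unfolding minimal_generators_def by auto
qed

section \<open>The generators as a residue system modulo \<open>m\<close>\<close>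

text \<open>Otherwise \<open>d j\<close> splits into \<open>d i\<close> and a positive multiple of
  \<open>m = d 1\<close>, both nonzero elements of \<open>S\<close>.\<close>

lemma gen_residues_less:
  assumes "i \<in> {1..m}" "j \<in> {1..m}" "i < j"
  shows "int (d j) \<noteq> int (d i) + k * int m"
proof
  assume eq: "int (d j) = int (d i) + k * int m"
  have "0 < k * int m" using d_less_iff[OF assms(1,2)] assms(3) eq by simp
  then have k: "0 < k" using m_ge_2 by (simp add: zero_less_mult_iff)
  show False
    using gen_irreducible[OF assms(2) gen_in_S[OF assms(1)] _ mult_m_in_S[of k]]
      d_ge_m[OF assms(1)] m_ge_2 k eq by auto
qed

lemma gen_residue_unique:
  assumes "i \<in> {1..m}" "j \<in> {1..m}" "int (d i) + k * int m = int (d j) + l * int m"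
  shows "i = j \<and> k = l"
proof -
  have eq1: "int (d j) = int (d i) + (k - l) * int m" and eq2: "int (d i) = int (d j) + (l - k) * int m"
    using assms(3) by (auto simp: algebra_simps)
  have "i = j"
    using gen_residues_less[OF assms(1,2) _ ] gen_residues_less[OF assms(2,1)] eq1 eq2
    by (metis linorder_neqE_nat)
  then show ?thesis using assms(3) m_ge_2 by simp
qed

text \<open>Maximal embedding dimension makes the number of generators equal to the modulus, so
  pairwise incongruent generators hit every residue.\<close>

lemma gen_residue_exists:
  obtains i k where "i \<in> {1..m}" "x = int (d i) + k * int m"
proof -
  let ?r = "\<lambda>i. int (d i) mod int m"
  have "inj_on ?r {1..m}"
  proof (rule inj_onI)
    fix i j assume ij: "i \<in> {1..m}" "j \<in> {1..m}" "?r i = ?r j"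
    have "int (d i) + (- (int (d i) div int m)) * int m =
          int (d j) + (- (int (d j) div int m)) * int m"
      using ij(3) by (simp add: minus_div_mult_eq_mod)
    then show "i = j" using gen_residue_unique[OF ij(1,2)] by blast
  qed
  then have "card (?r ` {1..m}) = card {0..<int m}" by (simp add: card_image)
  moreover have "?r ` {1..m} \<subseteq> {0..<int m}" using m_ge_2 by auto
  ultimately have "?r ` {1..m} = {0..<int m}" by (intro card_subset_eq) auto
  moreover have "x mod int m \<in> {0..<int m}" using m_ge_2 by simp
  ultimately have "x mod int m \<in> ?r ` {1..m}" by simp
  then obtain i where i: "i \<in> {1..m}" "x mod int m = ?r i" by (rule imageE)
  have "x = int (d i) + (x div int m - int (d i) div int m) * int m"
    using i(2) div_mult_mod_eq[of x "int m"] div_mult_mod_eq[of "int (d i)" "int m"]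
    by (simp only: left_diff_distrib)
  then show thesis using i(1) that by blast
qed

text \<open>For negative \<open>k\<close> and \<open>i \<noteq> 1\<close>, adding
  \<open>- k * m\<close> back would decompose \<open>d i\<close>. The index 1 is exceptional because
  \<open>d 1 - m = 0\<close> lies in \<open>S\<close>.\<close>

lemma gen_shift_in_S_iff:
  assumes "i \<in> {1..m}"
  shows "int (d i) + k * int m \<in> S \<longleftrightarrow> (if i = 1 then - 1 \<le> k else 0 \<le> k)"
proof (cases "i = 1")
  case True
  have "- 1 \<le> k" if "(k + 1) * int m \<in> S"
    using S_nonneg[OF that] m_ge_2 by (simp add: zero_le_mult_iff)
  moreover have "(k + 1) * int m \<in> S" if "- 1 \<le> k"
    using mult_m_in_S[of "k + 1"] that by simp
  ultimately show ?thesis using True by (auto simp: algebra_simps)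
next
  case False
  have "0 \<le> k" if mem: "int (d i) + k * int m \<in> S"
  proof (rule ccontr)
    assume "\<not> 0 \<le> k"
    \<comment> \<open>Zero is \<open>d 1 + (-1) * m\<close>, so uniqueness of the residue would
      force \<open>i = 1\<close>.\<close>
    moreover have "int (d i) + k * int m \<noteq> 0"
      using gen_residue_unique[OF assms, of 1 k "-1"] False m_ge_2 by auto
    ultimately show False
      using gen_irreducible[OF assms mem _ mult_m_in_S[of "- k"]] m_ge_2 by auto
  qed
  moreover have "int (d i) + k * int m \<in> S" if "0 \<le> k"
    using S_add[OF gen_in_S[OF assms] mult_m_in_S[OF that]] .
  ultimately show ?thesis using False by auto
qed

section \<open>Frobenius number and pseudo-Frobenius numbers\<close>

lemma frobenius_number_eq: "frobenius_number S = int (d m) - int m"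
  unfolding frobenius_number_def
proof (rule Greatest_equality)
  show "int (d m) - int m \<notin> S"
    using gen_shift_in_S_iff[of m "-1"] m_ge_2 by simp
next
  fix x assume x: "x \<notin> S"
  obtain i k where ik: "i \<in> {1..m}" "x = int (d i) + k * int m" by (rule gen_residue_exists)
  have "k \<le> -1" using x ik gen_shift_in_S_iff[of i k] by (auto split: if_splits)
  then have "k * int m \<le> (-1) * int m" by (intro mult_right_mono) auto
  moreover have "d i \<le> d m" using ik(1) d_le_iff[of i m] by simp
  ultimately show "x \<le> int (d m) - int m" using ik(2) by simp
qed

text \<open>By irreducibility the sum is not a generator, so it exceeds the generator of its class
  by at least \<open>m\<close>, and one \<open>m\<close> can be spared.\<close>

lemma gen_add_gen_minus_m_in_S:
  assumes "i \<in> {1..m}" "j \<in> {1..m}"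
  shows "int (d i) + int (d j) - int m \<in> S"
proof -
  obtain l k where lk: "l \<in> {1..m}" "int (d i) + int (d j) = int (d l) + k * int m"
    by (rule gen_residue_exists)
  have "int (d l) + k * int m \<in> S"
    using S_add[OF gen_in_S gen_in_S, OF assms] lk(2) by simp
  then have k: "if l = 1 then - 1 \<le> k else 0 \<le> k"
    using gen_shift_in_S_iff lk(1) by simp
  have nz: "int (d i) \<noteq> 0" "int (d j) \<noteq> 0" using d_ge_m[OF assms(1)] d_ge_m[OF assms(2)] m_ge_2 by auto
  have "k \<noteq> 0"
    using gen_irreducible[OF lk(1) gen_in_S[OF assms(1)] nz(1) gen_in_S[OF assms(2)] nz(2)] lk(2)
    by auto
  moreover have "k \<noteq> - 1" if "l = 1"
    using lk(2) that nz by auto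
  ultimately have "if l = 1 then - 1 \<le> k - 1 else 0 \<le> k - 1" using k by auto
  then have "int (d l) + (k - 1) * int m \<in> S" using gen_shift_in_S_iff[OF lk(1)] by simp
  then show ?thesis using lk(2) by (simp add: algebra_simps)
qed

lemma pseudo_frobenius_eq: "pseudo_frobenius S = (\<lambda>i. int (d i) - int m) ` {2..m}"
proof (intro equalityI subsetI)
  fix x assume "x \<in> pseudo_frobenius S"
  then have x: "x \<notin> S" "\<And>s. s \<in> S \<Longrightarrow> s \<noteq> 0 \<Longrightarrow> x + s \<in> S"
    unfolding pseudo_frobenius_def by auto
  obtain i k where ik: "i \<in> {1..m}" "x = int (d i) + k * int m" by (rule gen_residue_exists)
  have "x + int m \<in> S" using x(2)[of "int m"] mult_m_in_S[of 1] m_ge_2 by simp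
  then have "int (d i) + (k + 1) * int m \<in> S" using ik(2) by (simp add: algebra_simps)
  \<comment> \<open>As \<open>x\<close> is outside \<open>S\<close> and \<open>x + m\<close> inside,
    \<open>x\<close> is the highest gap of its residue class; for multiples of \<open>m\<close> this
    gap is \<open>- m\<close>.\<close>
  then have k: "if i = 1 then k = - 2 else k = - 1"
    using x(1) ik gen_shift_in_S_iff[OF ik(1)] by (auto split: if_splits)
  have "i \<noteq> 1"
  proof
    assume "i = 1"
    then have xm: "x = - int m" using k ik(2) by simp
    \<comment> \<open>The candidate \<open>- m\<close> fails at \<open>d 2\<close>, since
      \<open>d 2 - m\<close> is a gap.\<close>
    have "x + int (d 2) \<in> S"
      using x(2)[of "int (d 2)"] gen_in_S[of 2] d_ge_m[of 2] m_ge_2 by auto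
    then show False using xm gen_shift_in_S_iff[of 2 "-1"] m_ge_2 by simp
  qed
  then show "x \<in> (\<lambda>i. int (d i) - int m) ` {2..m}"
    using k ik by (intro image_eqI[of _ _ i]) auto
next
  fix x assume "x \<in> (\<lambda>i. int (d i) - int m) ` {2..m}"
  then obtain i where i: "i \<in> {2..m}" "x = int (d i) - int m" by blast
  have "x \<notin> S" using gen_shift_in_S_iff[of i "-1"] i by auto
  moreover have "x + s \<in> S" if s: "s \<in> S" "s \<noteq> 0" for s
  proof -
    \<comment> \<open>Peeling one generator off \<open>s\<close> reduces the claim to a sum of two
      generators.\<close>
    obtain j where j: "j \<in> {1..m}" "s - int (d j) \<in> S"
      using combinations_eq_0_or_diff[of "{1..m}" s d] s unfolding semigroup_generated_def by auto
    have "int (d i) + int (d j) - int m \<in> S"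
      using gen_add_gen_minus_m_in_S[of i j] i(1) j(1) by auto
    from S_add[OF this j(2)] have "int (d i) - int m + s \<in> S" by (simp add: algebra_simps)
    then show ?thesis unfolding i(2) .
  qed
  ultimately show "x \<in> pseudo_frobenius S" unfolding pseudo_frobenius_def by auto
qed

lemma proper_pseudo_frobenius_eq:
  "pseudo_frobenius S - {frobenius_number S} = (\<lambda>i. int (d i) - int m) ` {2..<m}"
proof -
  have "d i \<noteq> d m" if "i \<in> {2..<m}" for i
    using d_less_iff[of i m] that by auto
  moreover have "{2..m} = insert m {2..<m}" using m_ge_2 by auto
  ultimately show ?thesis unfolding pseudo_frobenius_eq frobenius_number_eq by auto
qed

text \<open>If \<open>F - x\<close> were in \<open>S\<close>, adding this nonzero element to
  \<open>x\<close> would put \<open>F\<close> into \<open>S\<close>. Almost symmetry thus amounts to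
  the reverse inclusion.\<close>

lemma proper_pseudo_frobenius_subset:
  "pseudo_frobenius S - {frobenius_number S} \<subseteq> symmetric_gaps S"
proof
  fix x assume "x \<in> pseudo_frobenius S - {frobenius_number S}"
  then have x: "x \<notin> S" "\<And>s. s \<in> S \<Longrightarrow> s \<noteq> 0 \<Longrightarrow> x + s \<in> S" "x \<noteq> frobenius_number S"
    unfolding pseudo_frobenius_def by auto
  have "frobenius_number S \<notin> S"
    unfolding frobenius_number_eq using gen_shift_in_S_iff[of m "-1"] m_ge_2 by simp
  then have "frobenius_number S - x \<notin> S"
    using x(2)[of "frobenius_number S - x"] x(3) by auto
  then show "x \<in> symmetric_gaps S" using x(1) unfolding symmetric_gaps_def by simp
qed

section \<open>Almost symmetry and the symmetry of the generators\<close>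

lemma almost_symmetric_if_symmetric_gens:
  assumes sym: "\<And>j. j \<in> {1..m} \<Longrightarrow> d j + d (m - j + 1) = m + d m"
  shows "almost_symmetric S"
  unfolding almost_symmetric_def
proof (rule equalityI[OF proper_pseudo_frobenius_subset], rule subsetI)
  fix h assume "h \<in> symmetric_gaps S"
  then have h: "h \<notin> S" "int (d m) - int m - h \<notin> S"
    unfolding symmetric_gaps_def frobenius_number_eq by auto
  obtain i k where ik: "i \<in> {1..m}" "h = int (d i) + k * int m" by (rule gen_residue_exists)
  have k: "if i = 1 then k < - 1 else k < 0"
    using h(1) ik gen_shift_in_S_iff[OF ik(1)] by (auto split: if_splits)
  define j where "j = m - i + 1"
  have j: "j \<in> {1..m}" "int (d m) = int (d i) + int (d j) - int m"
    using sym[OF ik(1)] ik(1) unfolding j_def by auto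
  \<comment> \<open>This is \<open>F - h\<close>, with \<open>d m\<close> replaced by means of the
    mirrored generator.\<close>
  have "int (d j) + (- 2 - k) * int m \<notin> S"
    using h(2) ik(2) j(2) by (simp add: algebra_simps)
  then have k': "if j = 1 then - 2 - k < - 1 else - 2 - k < 0"
    using gen_shift_in_S_iff[OF j(1)] by (auto split: if_splits)
  \<comment> \<open>At \<open>i = 1\<close> and \<open>i = m\<close> the bounds on \<open>k\<close>
    contradict each other; in between they leave only \<open>k = - 1\<close>.\<close>
  have "j = 1 \<longleftrightarrow> i = m" "j = m \<longleftrightarrow> i = 1" using ik(1) unfolding j_def by auto
  then have "k = - 1" "i \<in> {2..<m}"
    using k k' ik(1) m_ge_2 by (auto split: if_splits)
  then show "h \<in> pseudo_frobenius S - {frobenius_number S}"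
    unfolding proper_pseudo_frobenius_eq using ik(2) by auto
qed

lemma symmetric_gens_if_almost_symmetric:
  assumes "almost_symmetric S" and j: "j \<in> {1..m}"
  shows "d j + d (m - j + 1) = m + d m"
proof -
  have gaps: "symmetric_gaps S = (\<lambda>i. int (d i) - int m) ` {2..<m}"
    using assms(1) proper_pseudo_frobenius_eq unfolding almost_symmetric_def by simp
  have "\<exists>l\<in>{1..m}. d i + d l = m + d m" if i: "i \<in> {1..m}" for i
  proof -
    \<comment> \<open>The end indices are paired with each other because \<open>d 1 = m\<close>;
      only the inner ones correspond to elements of \<open>symmetric_gaps S\<close>.\<close>
    consider "i = 1" | "i = m" | "i \<in> {2..<m}" using i by force
    then show ?thesis
    proof cases
      case 1
      then show ?thesis using m_ge_2 by (intro bexI[of _ m]) auto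
    next
      case 2
      then show ?thesis using m_ge_2 by (intro bexI[of _ 1]) auto
    next
      case 3
      then have "int (d i) - int m \<in> symmetric_gaps S" using gaps by auto
      \<comment> \<open>This is the reflection \<open>h \<mapsto> F - h\<close> applied to
        \<open>d i - m\<close>.\<close>
      then have "int (d m) - int (d i) \<in> symmetric_gaps S"
        unfolding symmetric_gaps_def frobenius_number_eq by auto
      then obtain l where "l \<in> {2..<m}" "int (d m) - int (d i) = int (d l) - int m"
        using gaps by auto
      then show ?thesis by (intro bexI[of _ l]) auto
    qed
  qed
  then obtain r where r: "\<And>i. i \<in> {1..m} \<Longrightarrow> r i \<in> {1..m}"
    "\<And>i. i \<in> {1..m} \<Longrightarrow> d i + d (r i) = m + d m"
    by metis
  have anti: "r k < r i" if "i \<in> {1..m}" "k \<in> {1..m}" "i < k" for i k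
  proof -
    have "d i < d k" using that d_less_iff by simp
    then have "d (r k) < d (r i)" using r(2)[OF that(1)] r(2)[OF that(2)] by linarith
    then show ?thesis using r(1) that d_less_iff by simp
  qed
  \<comment> \<open>Composing the order-reversing \<open>r\<close> with the reversal of the indices
    gives a strictly increasing self-map, which must be the identity.\<close>
  have "m + 1 - r j = j"
  proof (rule strict_mono_on_self_map_eq[OF _ _ j])
    show "strict_mono_on {1..m} (\<lambda>i. m + 1 - r i)"
      using anti r(1) by (intro strict_mono_onI diff_less_mono2) (auto simp: less_Suc_eq_le)
    show "(\<lambda>i. m + 1 - r i) ` {1..m} \<subseteq> {1..m}"
      using r(1) by fastforce
  qed
  then have "r j = m - j + 1" using r(1)[OF j] j by auto
  then show ?thesis using r(2)[OF j] by simp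
qed

end

theorem theorem7:
  fixes m :: nat and d :: "nat \<Rightarrow> nat"
  assumes "2 \<le> m"
    and "minimal_generators m d"
    and "strict_mono_on {1..m} d"
    and "max_embedding_dim m d"
  shows "almost_symmetric (semigroup_generated m d) \<longleftrightarrow>
         (\<forall>j\<in>{1..m}. d j + d (m - j + 1) = m + d m)"
proof -
  interpret med_semigroup m d using assms by unfold_locales
  show ?thesis
    using almost_symmetric_if_symmetric_gens symmetric_gens_if_almost_symmetric by blast
qed

end
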